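(* Let $g:[0,1]\to[0,1]$ be a carcass map which is topologically conjugated to the tent map $f$. If all continuous surjective solutions $\psi:[0,1]\to[0,1]$ of the functional equation $\psi\circ g=g\circ\psi$ are piecewise linear, then the conjugacy of $g$ and the tent map, i.e. the homeomorphism $h:[0,1]\to[0,1]$ with $h\circ f=g\circ h$, is piecewise linear.
   Context: A map $g:[0,1]\to[0,1]$ is unimodal if it is continuous and there is $v\in(0,1)$ such that $g$ is (strictly) increasing on $[0,v]$, (strictly) decreasing on $[v,1]$, and $g(0)=g(1)=0$, $g(v)=1$. The tent map is $f:[0,1]\to[0,1]$, $f(x)=1-|1-2x|$. A map is linear if its graph is a line or a line segment; it is piecewise linear if its domain can be divided into finitely many intervals on each of which the map is linear. A carcass map is a piecewise linear unimodal map. $g$ is topologically conjugated to $f$ if there is a homeomorphism $h:[0,1]\to[0,1]$ with $h\circ f=g\circ h$; such $h$, when it exists, is unique and is called the conjugacy. *)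

theory Defs
  imports "HOL-Analysis.Analysis" "HOL-Library.Disjoint_Sets"
begin

text \<open>
  A map \<open>[0,1] \<rightarrow> [0,1]\<close> is represented by a function on all of \<open>real\<close>; only its
  values on \<open>{0..1}\<close> matter.
\<close>

definition tent :: "real \<Rightarrow> real" where
  "tent x = 1 - \<bar>1 - 2 * x\<bar>"

definition unimodal :: "(real \<Rightarrow> real) \<Rightarrow> bool" where
  "unimodal g \<longleftrightarrow>
     g ` {0..1} \<subseteq> {0..1} \<and> continuous_on {0..1} g \<and>
     (\<exists>v. 0 < v \<and> v < 1 \<and>
        strict_mono_on {0..v} g \<and> strict_antimono_on {v..1} g \<and>
        g 0 = 0 \<and> g 1 = 0 \<and> g v = 1)"

text \<open>Linear in the sense that the graph lies on a line; a constant term is allowed.\<close>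

definition linear_map_on :: "real set \<Rightarrow> (real \<Rightarrow> real) \<Rightarrow> bool" where
  "linear_map_on I f \<longleftrightarrow> (\<exists>a b. \<forall>x\<in>I. f x = a * x + b)"

text \<open>
  The pieces may be open, closed, half-open or single points. Single points allow jumps,
  so continuity is not implied and has to be required separately.
\<close>

definition piecewise_linear_on :: "real set \<Rightarrow> (real \<Rightarrow> real) \<Rightarrow> bool" where
  "piecewise_linear_on S f \<longleftrightarrow>
     (\<exists>P. finite P \<and> partition_on S P \<and> (\<forall>I\<in>P. is_interval I \<and> linear_map_on I f))"

definition carcass :: "(real \<Rightarrow> real) \<Rightarrow> bool" where
  "carcass g \<longleftrightarrow> unimodal g \<and> piecewise_linear_on {0..1} g"

definition conjugacy :: "(real \<Rightarrow> real) \<Rightarrow> (real \<Rightarrow> real) \<Rightarrow> (real \<Rightarrow> real) \<Rightarrow> bool" where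
  "conjugacy f g h \<longleftrightarrow>
     (\<exists>k. homeomorphism {0..1} {0..1} h k) \<and> (\<forall>x\<in>{0..1}. h (f x) = g (h x))"

end

theory Submission
  imports Defs
begin

text \<open>
  For every integer \<open>t\<close> the triangle wave \<open>x \<mapsto> tri (t x)\<close> commutes with the tent map, so its conjugate
  by \<open>h\<close> commutes with \<open>g\<close> and is therefore linear near 0. This gives \<open>h (t x) = b\<^sub>t h x\<close> near 0, and
  hence a scaling law for every rational factor. On the other hand \<open>g\<^sup>n\<close> is piecewise linear and
  \<open>tent\<^sup>n\<close> folds at \<open>y = 2\<^sup>-\<^sup>N\<close>, so \<open>h y - h (y - d) = C h d\<close> for small \<open>d\<close>. Scaling this relation by
  rationals and passing to the limit shows that the increments of \<open>h\<close> are translation invariant, so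
  \<open>h\<close> is affine to the left of \<open>y\<close> by Cauchy's functional equation. Finally \<open>tent\<^sup>n\<close> stretches a small
  interval ending at \<open>y\<close> over \<open>[0,1]\<close>, which writes \<open>h\<close> as \<open>g\<^sup>n\<close> applied to an affine map.
\<close>

section \<open>One-sided germs of piecewise linear maps\<close>

text \<open>If points of \<open>I\<close> come arbitrarily close to \<open>p\<close> from the right,
  convexity fills all gaps between them. So no interval can be met and missed infinitely often on
  the way to \<open>p\<close>.\<close>

lemma eventually_in_interval_at_right:
  fixes I :: "real set"
  assumes "is_interval I"
  shows "eventually (\<lambda>x. x \<in> I) (at_right p) \<or> eventually (\<lambda>x. x \<notin> I) (at_right p)"
proof (cases "\<exists>b>p. \<forall>y>p. y < b \<longrightarrow> y \<notin> I")
  case False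
  then obtain x0 where x0: "x0 > p" "x0 \<in> I"
    using gt_ex by blast
  have "x \<in> I" if x: "p < x" "x < x0" for x
  proof -
    obtain x1 where "p < x1" "x1 < x" "x1 \<in> I"
      using False x(1) by blast
    then show ?thesis
      using x x0 assms unfolding is_interval_1 by (meson less_imp_le)
  qed
  then show ?thesis
    using x0 unfolding eventually_at_right_field by blast
qed (simp add: eventually_at_right_field)

lemma eventually_in_interval_at_left:
  fixes I :: "real set"
  assumes "is_interval I"
  shows "eventually (\<lambda>x. x \<in> I) (at_left p) \<or> eventually (\<lambda>x. x \<notin> I) (at_left p)"
proof (cases "\<exists>b<p. \<forall>y>b. y < p \<longrightarrow> y \<notin> I")
  case False
  then obtain x0 where x0: "x0 < p" "x0 \<in> I"
    using lt_ex by blast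
  have "x \<in> I" if x: "x0 < x" "x < p" for x
  proof -
    obtain x1 where "x < x1" "x1 < p" "x1 \<in> I"
      using False x(2) by blast
    then show ?thesis
      using x x0 assms unfolding is_interval_1 by (meson less_imp_le)
  qed
  then show ?thesis
    using x0 unfolding eventually_at_left_field by blast
qed (simp add: eventually_at_left_field)

text \<open>Of finitely many pieces covering \<open>S\<close>, one must eventually contain the
  filter: otherwise all of them are eventually avoided, and hence so is \<open>S\<close>. A general
  filter serves left and right germs at once.\<close>

lemma piecewise_linear_on_eventually:
  assumes pl: "piecewise_linear_on S f" and S: "eventually (\<lambda>x. x \<in> S) F" and "F \<noteq> bot"
    and F: "\<And>I. is_interval I \<Longrightarrow> eventually (\<lambda>x. x \<in> I) F \<or> eventually (\<lambda>x. x \<notin> I) F"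
  obtains a b where "eventually (\<lambda>x. f x = a * x + b) F"
proof -
  obtain P where P: "finite P" "partition_on S P" "\<And>I. I \<in> P \<Longrightarrow> is_interval I"
      "\<And>I. I \<in> P \<Longrightarrow> linear_map_on I f"
    using pl unfolding piecewise_linear_on_def by blast
  obtain I where I: "I \<in> P" "eventually (\<lambda>x. x \<in> I) F"
  proof (rule ccontr)
    assume "\<not> thesis"
    then have "\<forall>I\<in>P. eventually (\<lambda>x. x \<notin> I) F"
      using that F P(3) by blast
    then have "eventually (\<lambda>x. \<forall>I\<in>P. x \<notin> I) F"
      by (simp add: eventually_ball_finite P(1))
    with S have "eventually (\<lambda>x. False) F"
      by eventually_elim (use P(2) in \<open>auto simp: partition_on_def\<close>)
    then show False
      using \<open>F \<noteq> bot\<close> by simp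
  qed
  obtain a b where "\<forall>x\<in>I. f x = a * x + b"
    using P(4)[OF I(1)] unfolding linear_map_on_def by blast
  with I(2) have "eventually (\<lambda>x. f x = a * x + b) F"
    by (auto elim: eventually_mono)
  then show thesis
    by (rule that)
qed

text \<open>The germ only gives an affine formula on a punctured neighbourhood, as \<open>p\<close>
  may belong to a different piece. Continuity carries the formula over to \<open>p\<close>.\<close>

lemma piecewise_linear_on_at_right:
  assumes "piecewise_linear_on {u..v} f" "continuous_on {u..v} f" "u \<le> p" "p < v"
  obtains a \<eta> where "\<eta> > 0" "\<And>x. p \<le> x \<Longrightarrow> x < p + \<eta> \<Longrightarrow> f x = f p + a * (x - p)"
proof -
  have "eventually (\<lambda>x. x \<in> {u..v}) (at_right p)"
    unfolding eventually_at_right_field using assms(3,4) by (intro exI[of _ v]) auto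
  then obtain a b where "eventually (\<lambda>x. f x = a * x + b) (at_right p)"
    using assms(1) eventually_in_interval_at_right
    by (metis piecewise_linear_on_eventually trivial_limit_at_right_real)
  then obtain q where q: "q > p" "\<And>x. p < x \<Longrightarrow> x < q \<Longrightarrow> f x = a * x + b"
    unfolding eventually_at_right_field by blast
  define w where "w = min q v"
  have w: "p < w" "w \<le> q" "w \<le> v"
    using q(1) assms(4) by (auto simp: w_def)
  have "f p - (a * p + b) = 0"
  proof (rule continuous_constant_on_closure[where S = "{p<..<w}" and f = "\<lambda>x. f x - (a * x + b)"])
    have "continuous_on {p..w} f"
      by (rule continuous_on_subset[OF assms(2)]) (use w assms(3) in auto)
    then show "continuous_on (closure {p<..<w}) (\<lambda>x. f x - (a * x + b))"
      using w(1) by (auto intro!: continuous_intros)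
    show "p \<in> closure {p<..<w}"
      using w(1) by simp
    show "f x - (a * x + b) = 0" if "x \<in> {p<..<w}" for x
      using q(2)[of x] w that by simp
  qed
  then have "f x = f p + a * (x - p)" if "p \<le> x" "x < p + (q - p)" for x
    using q(2)[of x] that by (cases "x = p") (simp_all add: right_diff_distrib)
  then show thesis
    by (intro that[of "q - p" a]) (use q(1) in simp, blast)
qed

lemma piecewise_linear_on_at_left:
  assumes "piecewise_linear_on {u..v} f" "continuous_on {u..v} f" "u < p" "p \<le> v"
  obtains a \<eta> where "\<eta> > 0" "\<And>x. p - \<eta> < x \<Longrightarrow> x \<le> p \<Longrightarrow> f x = f p + a * (x - p)"
proof -
  have "eventually (\<lambda>x. x \<in> {u..v}) (at_left p)"
    unfolding eventually_at_left_field using assms(3,4) by (intro exI[of _ u]) auto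
  then obtain a b where "eventually (\<lambda>x. f x = a * x + b) (at_left p)"
    using assms(1) eventually_in_interval_at_left
    by (metis piecewise_linear_on_eventually trivial_limit_at_left_real)
  then obtain q where q: "q < p" "\<And>x. q < x \<Longrightarrow> x < p \<Longrightarrow> f x = a * x + b"
    unfolding eventually_at_left_field by blast
  define w where "w = max q u"
  have w: "w < p" "q \<le> w" "u \<le> w"
    using q(1) assms(3) by (auto simp: w_def)
  have "f p - (a * p + b) = 0"
  proof (rule continuous_constant_on_closure[where S = "{w<..<p}" and f = "\<lambda>x. f x - (a * x + b)"])
    have "continuous_on {w..p} f"
      by (rule continuous_on_subset[OF assms(2)]) (use w assms(4) in auto)
    then show "continuous_on (closure {w<..<p}) (\<lambda>x. f x - (a * x + b))"
      using w(1) by (auto intro!: continuous_intros)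
    show "p \<in> closure {w<..<p}"
      using w(1) by simp
    show "f x - (a * x + b) = 0" if "x \<in> {w<..<p}" for x
      using q(2)[of x] w that by simp
  qed
  then have "f x = f p + a * (x - p)" if "p - (p - q) < x" "x \<le> p" for x
    using q(2)[of x] that by (cases "x = p") (simp_all add: right_diff_distrib)
  then show thesis
    by (intro that[of "p - q" a]) (use q(1) in simp, blast)
qed

section \<open>Composition and iteration of piecewise linear maps\<close>

text \<open>An affine map is monotone, so it keeps betweenness; the sign of \<open>a\<close> only
  decides the direction.\<close>

lemma is_interval_affine_vimage:
  fixes I J :: "real set"
  assumes "is_interval I" "is_interval J" and f: "\<forall>x\<in>I. f x = a * x + b"
  shows "is_interval (I \<inter> f -` J)"
  unfolding is_interval_1
proof (intro ballI allI impI)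
  fix x y z assume x: "x \<in> I \<inter> f -` J" and y: "y \<in> I \<inter> f -` J" and z: "x \<le> z \<and> z \<le> y"
  have zI: "z \<in> I"
    using x y z assms(1) unfolding is_interval_1 by blast
  have J: "a * x + b \<in> J" "a * y + b \<in> J"
    using x y f by auto
  have "a * z + b \<in> J"
  proof (cases "a \<ge> 0")
    case True
    then have "a * x + b \<le> a * z + b" "a * z + b \<le> a * y + b"
      using z by (auto intro: mult_left_mono)
    then show ?thesis
      using J assms(2) unfolding is_interval_1 by blast
  next
    case False
    then have "a * y + b \<le> a * z + b" "a * z + b \<le> a * x + b"
      using z by (auto intro: mult_left_mono_neg)
    then show ?thesis
      using J assms(2) unfolding is_interval_1 by blast
  qed
  then show "z \<in> I \<inter> f -` J"
    using zI f by simp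
qed

text \<open>The pieces of \<open>f\<close> are cut along the preimages of the pieces of
  \<open>g\<close>; on each resulting piece both maps are affine.\<close>

lemma piecewise_linear_on_compose:
  assumes "piecewise_linear_on S f" "piecewise_linear_on T g" "f ` S \<subseteq> T"
  shows "piecewise_linear_on S (\<lambda>x. g (f x))"
proof -
  obtain P where P: "finite P" "partition_on S P" "\<And>I. I \<in> P \<Longrightarrow> is_interval I"
      "\<And>I. I \<in> P \<Longrightarrow> linear_map_on I f"
    using assms(1) unfolding piecewise_linear_on_def by blast
  obtain Q where Q: "finite Q" "partition_on T Q" "\<And>J. J \<in> Q \<Longrightarrow> is_interval J"
      "\<And>J. J \<in> Q \<Longrightarrow> linear_map_on J g"
    using assms(2) unfolding piecewise_linear_on_def by blast
  \<comment> \<open>Empty intersections are removed because a partition has no empty member.\<close>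
  define R where "R = (\<lambda>(I, J). I \<inter> f -` J) ` (P \<times> Q) - {{}}"
  have "finite R"
    using P(1) Q(1) by (simp add: R_def)
  moreover have "partition_on S R"
  proof (rule partition_onI)
    show "\<Union>R = S"
    proof
      show "\<Union>R \<subseteq> S"
        using partition_onD1[OF P(2)] by (auto simp: R_def)
      show "S \<subseteq> \<Union>R"
      proof
        fix x assume "x \<in> S"
        then obtain I J where "I \<in> P" "x \<in> I" "J \<in> Q" "f x \<in> J"
          using partition_onD1[OF P(2)] partition_onD1[OF Q(2)] assms(3) by blast
        then show "x \<in> \<Union>R"
          unfolding R_def by (intro UnionI[of "I \<inter> f -` J"]) auto
      qed
    qed
    show "disjnt p q" if "p \<in> R" "q \<in> R" "p \<noteq> q" for p q
    proof -
      obtain I J where p: "p = I \<inter> f -` J" "I \<in> P" "J \<in> Q"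
        using \<open>p \<in> R\<close> by (auto simp: R_def)
      obtain I' J' where q: "q = I' \<inter> f -` J'" "I' \<in> P" "J' \<in> Q"
        using \<open>q \<in> R\<close> by (auto simp: R_def)
      have "I \<noteq> I' \<or> J \<noteq> J'"
        using that p q by auto
      then have "I \<inter> I' = {} \<or> J \<inter> J' = {}"
        using p q partition_onD2[OF P(2)] partition_onD2[OF Q(2)] by (metis disjointD)
      then show ?thesis
        unfolding disjnt_def p(1) q(1) by blast
    qed
  qed (auto simp: R_def)
  moreover have "is_interval K \<and> linear_map_on K (\<lambda>x. g (f x))" if "K \<in> R" for K
  proof -
    obtain I J where K: "K = I \<inter> f -` J" "I \<in> P" "J \<in> Q"
      using \<open>K \<in> R\<close> by (auto simp: R_def)
    obtain a b where f: "\<forall>x\<in>I. f x = a * x + b"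
      using P(4)[OF K(2)] unfolding linear_map_on_def by blast
    obtain c d where g: "\<forall>x\<in>J. g x = c * x + d"
      using Q(4)[OF K(3)] unfolding linear_map_on_def by blast
    have "g (f x) = (c * a) * x + (c * b + d)" if "x \<in> K" for x
    proof -
      have "g (f x) = c * f x + d" "f x = a * x + b"
        using that f g by (auto simp: K(1))
      then show ?thesis
        by (simp add: algebra_simps)
    qed
    then show ?thesis
      using is_interval_affine_vimage[OF P(3) Q(3) f] K unfolding linear_map_on_def by blast
  qed
  ultimately show ?thesis
    unfolding piecewise_linear_on_def by blast
qed

lemma piecewise_linear_on_affine:
  assumes "is_interval S" "S \<noteq> {}" and "\<And>x. x \<in> S \<Longrightarrow> f x = a * x + b"
  shows "piecewise_linear_on S f"
  unfolding piecewise_linear_on_def linear_map_on_def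
  by (rule exI[of _ "{S}"]) (use assms in \<open>auto simp: partition_on_space\<close>)

lemma piecewise_linear_on_cong:
  assumes "piecewise_linear_on S f" and "\<And>x. x \<in> S \<Longrightarrow> f x = g x"
  shows "piecewise_linear_on S g"
proof -
  obtain P where P: "finite P" "partition_on S P" "\<forall>I\<in>P. is_interval I \<and> linear_map_on I f"
    using assms(1) unfolding piecewise_linear_on_def by blast
  have "linear_map_on I g" if I: "I \<in> P" for I
  proof -
    have "I \<subseteq> S"
      using I partition_onD1[OF P(2)] by blast
    then show ?thesis
      using P(3) I assms(2) unfolding linear_map_on_def by (metis subsetD)
  qed
  then show ?thesis
    unfolding piecewise_linear_on_def using P by blast
qed

lemma piecewise_linear_on_funpow:
  assumes "piecewise_linear_on S g" "g ` S \<subseteq> S" "is_interval S" "S \<noteq> {}"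
  shows "piecewise_linear_on S (g ^^ n)"
proof (induction n)
  case 0
  show ?case
    by (rule piecewise_linear_on_affine[where a = 1 and b = 0]) (use assms in auto)
next
  case (Suc n)
  show ?case
    using piecewise_linear_on_compose[OF assms(1) Suc assms(2)]
    by (rule piecewise_linear_on_cong) (simp add: funpow_swap1)
qed

section \<open>Density of the rationals and Cauchy's functional equation\<close>

lemma constant_if_constant_on_Rats:
  fixes \<phi> :: "real \<Rightarrow> real"
  assumes "continuous_on {a..b} \<phi>" "a < b" and "\<And>r. r \<in> \<rat> \<Longrightarrow> a < r \<Longrightarrow> r < b \<Longrightarrow> \<phi> r = c"
    and "x \<in> {a..b}"
  shows "\<phi> x = c"
proof -
  have "{a<..<b} \<subseteq> closure ({a<..<b} \<inter> \<rat>)"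
    using open_Int_closure_subset[of "{a<..<b}" "\<rat> :: real set"] by (simp add: Rats_closure_real)
  then have "closure {a<..<b} \<subseteq> closure ({a<..<b} \<inter> \<rat>)"
    by (metis closure_minimal closed_closure)
  moreover have "closure ({a<..<b} \<inter> \<rat>) \<subseteq> closure {a<..<b}"
    by (rule closure_mono) blast
  ultimately have "closure ({a<..<b} \<inter> \<rat>) = {a..b}"
    using \<open>a < b\<close> by simp
  then show ?thesis
    using continuous_constant_on_closure[of "{a<..<b} \<inter> \<rat>" \<phi> c x] assms by auto
qed

lemma Rats_pos_cases:
  assumes "r \<in> \<rat>" "0 < r"
  obtains p q :: nat where "0 < p" "0 < q" "r = real p / real q"
proof -
  obtain p q :: nat where "q \<noteq> 0" "\<bar>r\<bar> = real p / real q"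
    using Rats_abs_nat_div_natE[OF assms(1)] by blast
  then have "r = real p / real q" "q > 0"
    using assms by auto
  moreover have "0 < p"
    using \<open>r = real p / real q\<close> assms(2) by (cases p) auto
  ultimately show thesis
    using that by blast
qed

text \<open>Cauchy's equation on a bounded interval: additivity settles the rational multiples of
  \<open>e\<close> in the interval, and continuity the remaining ones.\<close>

lemma additive_on_interval_linear:
  fixes \<phi> :: "real \<Rightarrow> real"
  assumes "0 < e" and cont: "continuous_on {0..e} \<phi>"
    and add: "\<And>x y. 0 \<le> x \<Longrightarrow> 0 \<le> y \<Longrightarrow> x + y \<le> e \<Longrightarrow> \<phi> (x + y) = \<phi> x + \<phi> y"
    and "x \<in> {0..e}"
  shows "\<phi> x = \<phi> e / e * x"
proof -
  have mult: "\<phi> (real n * z) = real n * \<phi> z" if "0 \<le> z" "real n * z \<le> e" for n z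
    using that
  proof (induction n)
    case 0
    then show ?case
      using add[of 0 0] \<open>0 < e\<close> by simp
  next
    case (Suc n)
    then show ?case
      using add[of z "real n * z"] by (simp add: algebra_simps)
  qed
  \<comment> \<open>Rescaling by \<open>e\<close> turns rational multiples of \<open>e\<close> into
    rational parameters \<open>t\<close>, where density applies.\<close>
  have "\<phi> (t * e) - t * \<phi> e = 0" if "t \<in> {0..1}" for t
  proof (rule constant_if_constant_on_Rats[where \<phi> = "\<lambda>t. \<phi> (t * e) - t * \<phi> e" and a = 0 and b = 1])
    have "continuous_on {0..1} (\<lambda>t. \<phi> (t * e))"
      by (rule continuous_on_compose2[OF cont])
        (use \<open>0 < e\<close> in \<open>auto intro!: continuous_intros mult_left_le_one_le\<close>)
    then show "continuous_on {0..1} (\<lambda>t. \<phi> (t * e) - t * \<phi> e)"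
      by (intro continuous_intros)
    show "\<phi> (r * e) - r * \<phi> e = 0" if r: "r \<in> \<rat>" "0 < r" "r < 1" for r
    proof -
      obtain p q :: nat where pq: "0 < p" "0 < q" "r = real p / real q"
        using Rats_pos_cases[OF r(1,2)] .
      have q: "\<phi> e = real q * \<phi> (e / real q)"
        using mult[of "e / real q" q] pq \<open>0 < e\<close> by simp
      have "r * e \<le> 1 * e"
        using r \<open>0 < e\<close> by (intro mult_right_mono) auto
      then have "real p * (e / real q) \<le> e"
        by (simp add: pq)
      then have "\<phi> (real p * (e / real q)) = real p * \<phi> (e / real q)"
        using pq \<open>0 < e\<close> by (intro mult) auto
      moreover have "r * e = real p * (e / real q)"
        using pq by simp
      moreover have "r * \<phi> e = real p * \<phi> (e / real q)"
        using pq q by simp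
      ultimately show ?thesis
        by simp
    qed
  qed (use that in auto)
  from this[of "x / e"] show ?thesis
    using assms(1,4) by simp
qed

section \<open>Triangle waves and iterates of the tent map\<close>

text \<open>This is the triangle wave of period 2, the distance to the nearest even integer. The
  cosine form turns multiplication of the argument into a Chebyshev identity.\<close>

definition tri :: "real \<Rightarrow> real" where
  "tri u = arccos (cos (pi * u)) / pi"

lemma tri_of_unit: "0 \<le> u \<Longrightarrow> u \<le> 1 \<Longrightarrow> tri u = u"
  by (simp add: tri_def arccos_cos)

lemma tri_in_unit: "tri u \<in> {0..1}"
  using arccos_lbound[of "cos (pi * u)"] arccos_ubound[of "cos (pi * u)"] by (simp add: tri_def)

lemma continuous_on_tri: "continuous_on S tri"
  unfolding tri_def by (intro continuous_intros) auto

text \<open>By the Chebyshev recurrence \<open>cos (n * a)\<close> is a polynomial in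
  \<open>cos a\<close>.\<close>

lemma cos_of_nat_mult_cong:
  fixes a b :: real
  assumes "cos a = cos b"
  shows "cos (real n * a) = cos (real n * b)"
proof (induction n rule: less_induct)
  case (less n)
  have step: "cos (real (Suc (Suc m)) * c) = 2 * cos c * cos (real (Suc m) * c) - cos (real m * c)"
    for m and c :: real
  proof -
    have "cos (real (Suc (Suc m)) * c) = cos (real (Suc m) * c + c)"
         "cos (real m * c) = cos (real (Suc m) * c - c)"
      by (simp_all add: algebra_simps)
    then show ?thesis
      by (simp add: cos_add cos_diff)
  qed
  consider "n = 0" | "n = 1" | m where "n = Suc (Suc m)"
    by (metis One_nat_def not0_implies_Suc)
  then show ?case
  proof cases
    case 3
    then show ?thesis
      using less[of m] less[of "Suc m"] assms unfolding 3 step by simp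
  qed (use assms in auto)
qed

lemma tri_mult_tri: "tri (real n * tri u) = tri (real n * u)"
proof -
  have "cos (pi * tri u) = cos (pi * u)"
    by (simp add: tri_def)
  then show ?thesis
    using cos_of_nat_mult_cong[of "pi * tri u" "pi * u" n]
    by (simp add: tri_def[of "real n * _"] mult.left_commute)
qed

lemma tent_eq_tri:
  assumes "x \<in> {0..1}"
  shows "tent x = tri (2 * x)"
proof (cases "x \<le> 1 / 2")
  case True
  then show ?thesis
    using assms tri_of_unit[of "2 * x"] by (simp add: tent_def)
next
  case False
  have "cos (pi * (2 * x)) = cos (pi * (2 - 2 * x))"
    using cos_diff[of "2 * pi" "pi * (2 * x)"] by (simp add: right_diff_distrib mult.commute)
  then show ?thesis
    using assms False tri_of_unit[of "2 - 2 * x"] by (simp add: tent_def tri_def)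
qed

text \<open>Since the tent map is \<open>tri (2 * x)\<close> on the unit interval, both sides reduce
  to \<open>tri (2 * n * x)\<close>.\<close>

lemma tri_mult_tent:
  assumes "x \<in> {0..1}"
  shows "tri (real n * tent x) = tent (tri (real n * x))"
  using tri_mult_tri[of n "2 * x"] tri_mult_tri[of 2 "real n * x"] tri_in_unit[of "real n * x"] assms
  by (simp add: tent_eq_tri mult.left_commute)

lemma tent_in_unit: "x \<in> {0..1} \<Longrightarrow> tent x \<in> {0..1}"
  by (auto simp: tent_def abs_if)

lemma funpow_tent_in_unit: "x \<in> {0..1} \<Longrightarrow> (tent ^^ n) x \<in> {0..1}"
  by (induction n) (auto simp del: atLeastAtMost_iff intro: tent_in_unit)

lemma funpow_tent_small: "0 \<le> x \<Longrightarrow> 2 ^ n * x \<le> 1 \<Longrightarrow> (tent ^^ n) x = 2 ^ n * x"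
proof (induction n)
  case (Suc n)
  have "2 ^ n * x \<le> 1" "0 \<le> 2 ^ n * x"
    using Suc.prems by auto
  then show ?case
    using Suc by (auto simp: tent_def algebra_simps)
qed simp

text \<open>\<open>tent ^^ n\<close> maps \<open>[2\<^sup>-\<^sup>N - 2\<^sup>-\<^sup>n, 2\<^sup>-\<^sup>N]\<close> affinely onto \<open>[0,1]\<close>, reversing the orientation.\<close>

lemma funpow_tent_left:
  assumes "N < n" "s \<in> {0..1}"
  shows "(tent ^^ n) (1 / 2 ^ N - s / 2 ^ n) = s"
proof -
  obtain m where n: "n = m + Suc N"
    using assms(1) by (metis add.commute add_Suc_right less_imp_Suc_add)
  have s: "0 \<le> s" "s \<le> 1"
    using assms(2) by auto
  have le: "2 * (s / 2 ^ Suc m) \<le> 1" "s / 2 ^ Suc m \<ge> 0"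
    using s one_le_power[of "2::real" m] by (auto simp: field_simps intro: order_trans)
  \<comment> \<open>The orbit has three phases: \<open>N\<close> doublings reach
    \<open>1 - s / 2 ^ Suc m\<close>, one fold gives \<open>s / 2 ^ m\<close>, and \<open>m\<close>
    further doublings give \<open>s\<close>.\<close>
  have e: "2 ^ N * (1 / 2 ^ N - s / 2 ^ n) = 1 - s / 2 ^ Suc m"
    by (simp add: n power_add field_simps)
  have "1 / 2 ^ N - s / 2 ^ n \<ge> 0"
    using e le by (smt (verit) mult_nonneg_nonneg mult_pos_neg zero_less_power)
  then have "(tent ^^ N) (1 / 2 ^ N - s / 2 ^ n) = 1 - s / 2 ^ Suc m"
    using funpow_tent_small[of "1 / 2 ^ N - s / 2 ^ n" N] e le by simp
  then have "(tent ^^ Suc N) (1 / 2 ^ N - s / 2 ^ n) = s / 2 ^ m"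
    using le by (simp add: tent_def)
  moreover have "(tent ^^ m) (s / 2 ^ m) = s"
    using funpow_tent_small[of "s / 2 ^ m" m] s by simp
  ultimately show ?thesis
    unfolding n funpow_add by simp
qed

lemma continuous_on_funpow:
  fixes g :: "'a::topological_space \<Rightarrow> 'a"
  assumes "continuous_on S g" "g ` S \<subseteq> S"
  shows "continuous_on S (g ^^ n)"
proof (induction n)
  case (Suc n)
  show ?case
    unfolding funpow_Suc_right
    by (rule continuous_on_compose[OF assms(1) continuous_on_subset[OF Suc assms(2)]])
qed (simp add: id_def)

section \<open>The conjugacy and its monotonicity\<close>

locale piecewise_linear_centralizer =
  fixes g h k :: "real \<Rightarrow> real"
  assumes carcass: "carcass g"
    and homeo: "homeomorphism {0..1} {0..1} h k"
    and conj: "\<And>x. x \<in> {0..1} \<Longrightarrow> h (tent x) = g (h x)"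
    and commuting_piecewise_linear:
      "\<And>\<psi>. continuous_on {0..1} \<psi> \<Longrightarrow> \<psi> ` {0..1} = {0..1} \<Longrightarrow>
        (\<forall>x\<in>{0..1}. \<psi> (g x) = g (\<psi> x)) \<Longrightarrow> piecewise_linear_on {0..1} \<psi>"
begin

lemma g_props: "g ` {0..1} \<subseteq> {0..1}" "continuous_on {0..1} g" "piecewise_linear_on {0..1} g"
    "g 0 = 0" "g 1 = 0"
  using carcass unfolding carcass_def unimodal_def by auto

lemma h_continuous: "continuous_on {0..1} h"
  using homeo by (rule homeomorphism_cont1)

lemma h_image: "h ` {0..1} = {0..1}"
  using homeo by (rule homeomorphism_image1)

lemma h_in_unit: "x \<in> {0..1} \<Longrightarrow> h x \<in> {0..1}"
  using h_image by blast

lemma h_surj: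
  assumes "y \<in> {0..1}"
  obtains x where "x \<in> {0..1}" "y = h x"
  using assms h_image by (metis imageE)

lemma k_h: "x \<in> {0..1} \<Longrightarrow> k (h x) = x"
  using homeo by (rule homeomorphism_apply1)

text \<open>A continuous injection on an interval is strictly monotone. A decreasing
  \<open>h\<close> would send 0 to 1, making 1 a fixed point of \<open>g\<close> because 0 is one of
  the tent map; but \<open>g 1 = 0\<close>.\<close>

lemma h_fixes_0_strict_mono: "h 0 = 0 \<and> strict_mono_on {0..1} h"
proof -
  have "inj_on h {0..1}"
    using k_h by (rule inj_on_inverseI)
  then consider "strict_mono_on {0..1} h" | "strict_antimono_on {0..1} h"
    using injective_eq_monotone_map[of "{0..1}" h] h_continuous by (auto simp: is_interval_cc)
  then show ?thesis
  proof cases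
    case 1
    obtain x where x: "x \<in> {0..1}" "h x = 0"
      using h_surj[of 0] by auto
    have "x = 0"
    proof (rule ccontr)
      assume "x \<noteq> 0"
      then have "h 0 < h x"
        using x 1 by (intro monotone_onD[OF 1]) auto
      then show False
        using x h_in_unit[of 0] by auto
    qed
    then show ?thesis
      using x 1 by simp
  next
    case 2
    obtain x where x: "x \<in> {0..1}" "h x = 1"
      using h_surj[of 1] by auto
    have "x = 0"
    proof (rule ccontr)
      assume "x \<noteq> 0"
      then have "h x < h 0"
        using x monotone_onD[OF 2, of 0 x] by auto
      then show False
        using x h_in_unit[of 0] by auto
    qed
    then show ?thesis
      using x conj[of 0] g_props by (simp add: tent_def)
  qed
qed

lemma h_0: "h 0 = 0"
  using h_fixes_0_strict_mono by blast

lemma h_less: "0 \<le> x \<Longrightarrow> x < y \<Longrightarrow> y \<le> 1 \<Longrightarrow> h x < h y"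
  using h_fixes_0_strict_mono by (auto elim: monotone_onD)

lemma h_pos: "0 < x \<Longrightarrow> x \<le> 1 \<Longrightarrow> 0 < h x"
  using h_less[of 0 x] h_0 by simp

lemma h_funpow_tent: "x \<in> {0..1} \<Longrightarrow> h ((tent ^^ n) x) = (g ^^ n) (h x)"
  by (induction n) (simp_all add: conj funpow_tent_in_unit del: atLeastAtMost_iff)

lemma h_near:
  assumes "p \<in> {0..1}" "\<eta> > 0"
  obtains \<delta> where "\<delta> > 0" "\<And>x. x \<in> {0..1} \<Longrightarrow> \<bar>x - p\<bar> < \<delta> \<Longrightarrow> \<bar>h x - h p\<bar> < \<eta>"
proof -
  have "\<exists>\<delta>>0. \<forall>x\<in>{0..1}. \<bar>x - p\<bar> < \<delta> \<longrightarrow> \<bar>h x - h p\<bar> < \<eta>"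
    using h_continuous assms unfolding continuous_on_iff dist_real_def by blast
  then show thesis
    using that by blast
qed

section \<open>Scaling laws for the conjugacy near 0\<close>

lemma scaling_germ:
  assumes "t \<ge> 1"
  obtains b \<delta> where "\<delta> > 0" "\<And>x. 0 \<le> x \<Longrightarrow> x < \<delta> \<Longrightarrow> h (real t * x) = b * h x"
proof -
  \<comment> \<open>The triangle wave with factor \<open>t\<close>, transported by \<open>h\<close>,
    commutes with \<open>g\<close>; near 0 it acts as multiplication by \<open>t\<close> in the
    coordinate of the tent map.\<close>
  define \<psi> where "\<psi> x = h (tri (real t * k x))" for x
  have \<psi>_h: "\<psi> (h x) = h (tri (real t * x))" if "x \<in> {0..1}" for x
    using k_h[OF that] by (simp add: \<psi>_def)
  have cont: "continuous_on {0..1} \<psi>"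
    unfolding \<psi>_def
    by (rule continuous_on_compose2[OF h_continuous])
      (use tri_in_unit in \<open>auto intro!: continuous_intros continuous_on_compose2[OF continuous_on_tri[of UNIV]]
         homeomorphism_cont2[OF homeo]\<close>)
  have image: "\<psi> ` {0..1} = {0..1}"
  proof
    show "\<psi> ` {0..1} \<subseteq> {0..1}"
      unfolding \<psi>_def using h_in_unit tri_in_unit by blast
    show "{0..1} \<subseteq> \<psi> ` {0..1}"
    proof
      fix v :: real assume "v \<in> {0..1}"
      then obtain w where w: "w \<in> {0..1}" "v = h w"
        using h_surj by blast
      \<comment> \<open>Surjectivity is already achieved on the first rising branch, where
        \<open>tri\<close> is the identity.\<close>
      then have "w / real t \<in> {0..1}"
        using \<open>t \<ge> 1\<close> by (auto simp: divide_le_eq)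
      moreover from this have "\<psi> (h (w / real t)) = v"
        using w \<open>t \<ge> 1\<close> by (simp add: \<psi>_h tri_of_unit)
      ultimately show "v \<in> \<psi> ` {0..1}"
        using h_in_unit by blast
    qed
  qed
  have "\<psi> (g x) = g (\<psi> x)" if "x \<in> {0..1}" for x
  proof -
    obtain u where u: "u \<in> {0..1}" "x = h u"
      using h_surj[OF \<open>x \<in> {0..1}\<close>] .
    have "\<psi> (g x) = h (tri (real t * tent u))"
      using \<psi>_h[OF tent_in_unit[OF u(1)]] u by (simp add: conj)
    also have "\<dots> = g (\<psi> x)"
      using tri_in_unit conj by (simp add: \<psi>_h u tri_mult_tent del: atLeastAtMost_iff)
    finally show ?thesis .
  qed
  with cont image have "piecewise_linear_on {0..1} \<psi>"
    by (intro commuting_piecewise_linear) auto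
  then obtain b \<eta> where b: "\<eta> > 0" "\<And>x. 0 \<le> x \<Longrightarrow> x < 0 + \<eta> \<Longrightarrow> \<psi> x = \<psi> 0 + b * (x - 0)"
    by (rule piecewise_linear_on_at_right[OF _ cont order_refl zero_less_one]) (rule that; iprover)
  have \<psi>_0: "\<psi> 0 = 0"
    using \<psi>_h[of 0] h_0 tri_of_unit[of 0] by simp
  obtain \<delta> where \<delta>: "\<delta> > 0" "\<And>x. x \<in> {0..1} \<Longrightarrow> \<bar>x - 0\<bar> < \<delta> \<Longrightarrow> \<bar>h x - h 0\<bar> < \<eta>"
    using h_near[of 0 \<eta>] b(1) by auto
  show thesis
  \<comment> \<open>The bound \<open>\<delta>\<close> keeps \<open>h x\<close> in the linear germ of
    \<open>\<psi>\<close>, and \<open>1 / real t\<close> keeps \<open>real t * x\<close> where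
    \<open>tri\<close> is the identity.\<close>
  proof (rule that[of "min \<delta> (1 / real t)" b])
    show "min \<delta> (1 / real t) > 0"
      using \<delta>(1) \<open>t \<ge> 1\<close> by simp
    fix x assume x: "0 \<le> x" "x < min \<delta> (1 / real t)"
    have tx: "real t * x \<le> 1" "0 \<le> real t * x"
      using x \<open>t \<ge> 1\<close> by (auto simp: field_simps)
    have "1 * x \<le> real t * x"
      using x \<open>t \<ge> 1\<close> by (intro mult_right_mono) auto
    then have x1: "x \<in> {0..1}"
      using x tx by simp
    then have "0 \<le> h x" "h x < \<eta>"
      using \<delta>(2)[of x] x h_in_unit[of x] h_0 by auto
    then show "h (real t * x) = b * h x"
      using b(2)[of "h x"] \<psi>_h[OF x1] tri_of_unit[OF tx(2,1)] \<psi>_0 by simp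
  qed
qed

text \<open>The scaling law for \<open>t = 2\<close> makes the range of validity of the other ones uniform in \<open>t\<close>.\<close>

lemma scaling:
  "\<exists>\<delta>>0. \<delta> \<le> 1 \<and> (\<forall>t\<ge>1. \<exists>b. \<forall>x\<ge>0. real t * x < \<delta> \<longrightarrow> h (real t * x) = b * h x)"
proof -
  obtain a \<delta>2 where a: "\<delta>2 > 0" "\<And>x. 0 \<le> x \<Longrightarrow> x < \<delta>2 \<Longrightarrow> h (2 * x) = a * h x"
    by (rule scaling_germ[of 2, unfolded of_nat_numeral]) (simp, (rule that; iprover))
  have iter: "h u = a ^ n * h (u / 2 ^ n)" if "0 \<le> u" "u < \<delta>2" for u n
  proof (induction n)
    case (Suc n)
    have "u / 2 ^ Suc n \<le> u / 1"
      using that(1) one_le_power[of "2::real" "Suc n"] by (intro divide_left_mono) auto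
    then have "u / 2 ^ Suc n < \<delta>2"
      using that by simp
    then show ?case
      using Suc a(2)[of "u / 2 ^ Suc n"] that by simp
  qed simp
  have "\<exists>b. \<forall>x\<ge>0. real t * x < min \<delta>2 1 \<longrightarrow> h (real t * x) = b * h x" if t: "t \<ge> 1" for t
  proof -
    obtain b \<delta> where b: "\<delta> > 0" "\<And>x. 0 \<le> x \<Longrightarrow> x < \<delta> \<Longrightarrow> h (real t * x) = b * h x"
      by (rule scaling_germ[OF t]) (rule that; iprover)
    show ?thesis
    proof (intro exI allI impI)
      fix x assume x: "0 \<le> x" "real t * x < min \<delta>2 1"
      \<comment> \<open>Repeated halving brings \<open>x\<close> into the range of the germ for
        \<open>t\<close>. Both \<open>h x\<close> and \<open>h (real t * x)\<close> pick up the same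
        factor \<open>a ^ n\<close>, so \<open>b\<close> is unchanged.\<close>
      obtain n where n: "x / \<delta> < 2 ^ n"
        using real_arch_pow[of 2 "x / \<delta>"] by auto
      then have "x / 2 ^ n < \<delta>"
        using b(1) by (simp add: field_simps)
      then have "h (real t * (x / 2 ^ n)) = b * h (x / 2 ^ n)"
        using x by (intro b(2)) auto
      moreover have "1 * x \<le> real t * x"
        using x t by (intro mult_right_mono) auto
      ultimately show "h (real t * x) = b * h x"
        using iter[of x n] iter[of "real t * x" n] x by simp
    qed
  qed
  then show ?thesis
    using a(1) by (intro exI[of _ "min \<delta>2 1"]) auto
qed

text \<open>For \<open>r = p / q\<close> the laws for \<open>p\<close> and \<open>q\<close> are
  compared at the common point \<open>x / q\<close>; the factor is the quotient of theirs.\<close>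

lemma rational_scaling:
  "\<exists>\<delta>>0. \<delta> \<le> 1 \<and> (\<forall>r\<in>\<rat>. 0 < r \<longrightarrow> (\<exists>c. \<forall>x\<ge>0. x < \<delta> \<longrightarrow> r * x < \<delta> \<longrightarrow> h (r * x) = c * h x))"
proof -
  obtain \<delta> where \<delta>: "0 < \<delta>" "\<delta> \<le> 1"
    and scale: "\<forall>t\<ge>1. \<exists>b. \<forall>x\<ge>0. real t * x < \<delta> \<longrightarrow> h (real t * x) = b * h x"
    using scaling by blast
  have "\<exists>c. \<forall>x\<ge>0. x < \<delta> \<longrightarrow> r * x < \<delta> \<longrightarrow> h (r * x) = c * h x" if r: "r \<in> \<rat>" "0 < r" for r
  proof -
    obtain p q :: nat where pq: "0 < p" "0 < q" "r = real p / real q"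
      using Rats_pos_cases[OF r] .
    obtain b where b: "\<forall>x\<ge>0. real p * x < \<delta> \<longrightarrow> h (real p * x) = b * h x"
      using scale[rule_format, of p] pq by auto
    obtain c where c: "\<forall>x\<ge>0. real q * x < \<delta> \<longrightarrow> h (real q * x) = c * h x"
      using scale[rule_format, of q] pq by auto
    have "h (\<delta> / 2) = c * h (\<delta> / 2 / real q)"
      using c[rule_format, of "\<delta> / 2 / real q"] \<delta>(1) pq by simp
    then have "c \<noteq> 0"
      using h_pos[of "\<delta> / 2"] \<delta> by auto
    have "h (r * x) = b / c * h x" if x: "0 \<le> x" "x < \<delta>" "r * x < \<delta>" for x
    proof -
      have "real p * (x / real q) = r * x"
        by (simp add: pq)
      then have "h (r * x) = b * h (x / real q)"
        using b[rule_format, of "x / real q"] x by simp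
      moreover have "h x = c * h (x / real q)"
        using c[rule_format, of "x / real q"] x pq by simp
      ultimately show ?thesis
        using \<open>c \<noteq> 0\<close> by simp
    qed
    then show ?thesis
      by blast
  qed
  then show ?thesis
    using \<delta> by (intro exI[of _ \<delta>]) simp
qed

section \<open>Germs to the left of dyadic points and translation invariance\<close>

lemma h_via_left_neighbourhood:
  assumes "N < n" "s \<in> {0..1}"
  shows "h s = (g ^^ n) (h (1 / 2 ^ N - s / 2 ^ n))"
    and "1 / 2 ^ N - s / 2 ^ n \<in> {0..1}"
proof -
  have "s / 2 ^ n \<le> 1 / 2 ^ n" "(1::real) / 2 ^ n \<le> 1 / 2 ^ N" "(1::real) / 2 ^ N \<le> 1"
    using assms by (auto intro!: divide_right_mono divide_left_mono power_increasing)
  moreover have "0 \<le> s / 2 ^ n"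
    using assms(2) by simp
  ultimately show *: "1 / 2 ^ N - s / 2 ^ n \<in> {0..1}"
    unfolding atLeastAtMost_iff by linarith
  show "h s = (g ^^ n) (h (1 / 2 ^ N - s / 2 ^ n))"
    using h_funpow_tent[OF *, of n] funpow_tent_left[OF assms] by simp
qed

text \<open>
  \<open>tent ^^ Suc N\<close> sends \<open>2\<^sup>-\<^sup>N - d\<close> to \<open>2\<^sup>N\<^sup>+\<^sup>1 d\<close>, and \<open>g ^^ Suc N\<close> is linear to the left of
  \<open>h (2\<^sup>-\<^sup>N)\<close>, so the left germ of \<open>h\<close> at \<open>2\<^sup>-\<^sup>N\<close> is a multiple of its germ at 0.
\<close>

lemma left_increment:
  assumes \<delta>: "0 < \<delta>" "\<forall>x\<ge>0. x < \<delta> \<longrightarrow> 2 ^ Suc N * x < \<delta> \<longrightarrow> h (2 ^ Suc N * x) = b * h x"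
  shows "\<exists>C \<epsilon>. \<epsilon> > 0 \<and> (\<forall>d\<ge>0. d < \<epsilon> \<longrightarrow> h (1 / 2 ^ N) - h (1 / 2 ^ N - d) = C * h d)"
proof -
  define y :: real where "y = 1 / 2 ^ N"
  define M :: real where "M = 2 ^ Suc N"
  have y: "0 < y" "y \<le> 1"
    by (auto simp: y_def)
  have M: "M > 0" "1 / M \<le> y"
    by (auto simp: M_def y_def field_simps)
  have M1: "1 \<le> M"
    unfolding M_def by (rule one_le_power) simp
  have via: "h (M * d) = (g ^^ Suc N) (h (y - d))" "y - d \<in> {0..1}"
    if "0 \<le> d" "d \<le> 1 / M" for d
    using h_via_left_neighbourhood[of N "Suc N" "M * d"] that M
    by (auto simp: y_def M_def field_simps)
  have "piecewise_linear_on {0..1} (g ^^ Suc N)"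
    by (rule piecewise_linear_on_funpow) (use g_props in \<open>auto simp: is_interval_cc\<close>)
  moreover have "continuous_on {0..1} (g ^^ Suc N)"
    by (rule continuous_on_funpow) (use g_props in auto)
  moreover have "0 < h y" "h y \<le> 1"
    using h_pos[OF y] h_in_unit[of y] y by auto
  ultimately obtain P \<eta> where P: "\<eta> > 0"
    "\<And>z. h y - \<eta> < z \<Longrightarrow> z \<le> h y \<Longrightarrow> (g ^^ Suc N) z = (g ^^ Suc N) (h y) + P * (z - h y)"
    by (rule piecewise_linear_on_at_left) (rule that; iprover)
  obtain \<delta>1 where \<delta>1: "\<delta>1 > 0" "\<And>x. x \<in> {0..1} \<Longrightarrow> \<bar>x - y\<bar> < \<delta>1 \<Longrightarrow> \<bar>h x - h y\<bar> < \<eta>"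
    using h_near[of y \<eta>] y P(1) by auto
  \<comment> \<open>The three bounds keep \<open>h (y - d)\<close> in the linear left germ of the
    iterate, \<open>M * d\<close> in the unit interval, and \<open>M * d\<close> in the range of the
    scaling law.\<close>
  define \<epsilon> where "\<epsilon> = min \<delta>1 (min (1 / M) (\<delta> / M))"
  have \<epsilon>: "\<epsilon> > 0"
    using \<delta>1(1) \<delta>(1) M by (simp add: \<epsilon>_def)
  have zero: "(g ^^ Suc N) (h y) = 0"
    using via(1)[of 0] h_0 M by simp
  have P_eq: "h (M * d) = P * (h (y - d) - h y)" if d: "0 \<le> d" "d < \<epsilon>" for d
  proof -
    have d': "d \<le> 1 / M" "d < \<delta>1"
      using d by (auto simp: \<epsilon>_def)
    have "\<bar>h (y - d) - h y\<bar> < \<eta>"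
      using \<delta>1(2)[of "y - d"] via(2)[OF d(1) d'(1)] d d' by simp
    moreover have "h (y - d) \<le> h y"
      using h_less[of "y - d" y] via(2)[OF d(1) d'(1)] d y by (cases "d = 0") auto
    ultimately show ?thesis
      using via(1)[OF d(1) d'(1)] P(2)[of "h (y - d)"] zero by simp
  qed
  \<comment> \<open>A zero slope \<open>P\<close> would force \<open>h\<close> to vanish at the
    positive point \<open>M * (\<epsilon> / 2)\<close>.\<close>
  have "0 < M * (\<epsilon> / 2)" "M * (\<epsilon> / 2) \<le> 1"
    using \<epsilon> M by (auto simp: \<epsilon>_def field_simps min_def)
  then have "P \<noteq> 0"
    using P_eq[of "\<epsilon> / 2"] h_pos[of "M * (\<epsilon> / 2)"] \<epsilon> by auto
  have "h y - h (y - d) = - (b / P) * h d" if d: "0 \<le> d" "d < \<epsilon>" for d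
  proof -
    have "M * d < \<delta>"
      using d M by (auto simp: \<epsilon>_def field_simps)
    moreover have "1 * d \<le> M * d"
      using M1 d(1) by (rule mult_right_mono)
    ultimately have "b * h d = P * (h (y - d) - h y)"
      using \<delta>(2)[folded M_def, rule_format, of d] P_eq[OF d] d by simp
    then show ?thesis
      using \<open>P \<noteq> 0\<close> by (simp add: field_simps)
  qed
  then show ?thesis
    unfolding y_def using \<epsilon> by blast
qed

text \<open>A rational \<open>r\<close> scales the increment law at \<open>y\<close> to one at
  \<open>r * y\<close>. The factor of \<open>r\<close> appears on both sides and is absorbed into
  \<open>h d\<close>, so \<open>C\<close> does not depend on \<open>r\<close>; continuity then
  reaches all real \<open>r\<close>.\<close>

lemma translation_invariant_increment:
  "\<exists>N C \<epsilon>. \<epsilon> > 0 \<and> \<epsilon> \<le> 1 / 2 ^ N \<and>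
    (\<forall>z\<in>{1 / 2 ^ N / 2..1 / 2 ^ N}. \<forall>d\<ge>0. d < \<epsilon> / 2 \<longrightarrow> h z - h (z - d) = C * h d)"
proof -
  obtain \<delta> where \<delta>: "0 < \<delta>" "\<delta> \<le> 1"
    and scale: "\<forall>r\<in>\<rat>. 0 < r \<longrightarrow> (\<exists>c. \<forall>x\<ge>0. x < \<delta> \<longrightarrow> r * x < \<delta> \<longrightarrow> h (r * x) = c * h x)"
    using rational_scaling by blast
  \<comment> \<open>The base point must lie below \<open>\<delta>\<close>, so that the scaling law
    applies to it.\<close>
  obtain N where N: "(1 / 2 :: real) ^ N < \<delta>"
    using real_arch_pow_inv[of \<delta> "1 / 2"] \<delta>(1) by auto
  define y :: real where "y = 1 / 2 ^ N"
  have y: "0 < y" "y \<le> 1" "y < \<delta>"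
    using N by (auto simp: y_def power_one_over)
  obtain b where "\<forall>x\<ge>0. x < \<delta> \<longrightarrow> 2 ^ Suc N * x < \<delta> \<longrightarrow> h (2 ^ Suc N * x) = b * h x"
    using scale[rule_format, of "2 ^ Suc N"] by auto
  then obtain C \<epsilon>1 where C: "\<epsilon>1 > 0" "\<forall>d\<ge>0. d < \<epsilon>1 \<longrightarrow> h y - h (y - d) = C * h d"
    using left_increment[OF \<delta>(1)] unfolding y_def by blast
  define \<epsilon> where "\<epsilon> = min \<epsilon>1 y"
  have inc: "h (r * y) - h (r * y - d) = C * h d"
    if d: "0 \<le> d" "d < \<epsilon> / 2" and r: "r \<in> {1/2..1}" for r d
  proof (rule constant_if_constant_on_Rats[where \<phi> = "\<lambda>r. h (r * y) - h (r * y - d)"])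
    have dy: "d \<le> y / 2" "d < \<epsilon>1 / 2"
      using d by (auto simp: \<epsilon>_def)
    have ry: "y / 2 \<le> r * y" "r * y \<le> 1" if "r \<in> {1/2..1}" for r
    proof -
      have "1 / 2 * y \<le> r * y" "r * y \<le> 1 * y"
        using that y by (auto intro!: mult_right_mono)
      then show "y / 2 \<le> r * y" "r * y \<le> 1"
        using y(2) by linarith+
    qed
    have "continuous_on {1/2..1} (\<lambda>r. h (r * y))"
      by (rule continuous_on_compose2[OF h_continuous]) (use ry y in \<open>fastforce intro!: continuous_intros\<close>)+
    moreover have "continuous_on {1/2..1} (\<lambda>r. h (r * y - d))"
      by (rule continuous_on_compose2[OF h_continuous])
        (use ry dy d(1) in \<open>fastforce intro!: continuous_intros\<close>)+
    ultimately show "continuous_on {1/2..1} (\<lambda>r. h (r * y) - h (r * y - d))"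
      by (intro continuous_intros)
    fix r :: real assume r: "r \<in> \<rat>" "1/2 < r" "r < 1"
    then obtain c where c: "\<forall>x\<ge>0. x < \<delta> \<longrightarrow> r * x < \<delta> \<longrightarrow> h (r * x) = c * h x"
      using scale[rule_format, of r] by auto
    have c': "h (r * x) = c * h x" if "0 \<le> x" "x < \<delta>" for x
    proof -
      have "r * x \<le> 1 * x"
        using r that by (intro mult_right_mono) auto
      then have "r * x < \<delta>"
        using that(2) by linarith
      then show ?thesis
        using c that by blast
    qed
    \<comment> \<open>Scaling back by \<open>r\<close> enlarges \<open>d\<close> at most twofold, as
      \<open>r > 1/2\<close>; hence the bound \<open>\<epsilon> / 2\<close> on
      \<open>d\<close>.\<close>
    define e where "e = d / r"
    have "e \<le> 2 * d"
      using r d mult_left_mono[of 1 "2 * r" d] by (simp add: e_def field_simps)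
    then have e: "0 \<le> e" "e < \<epsilon>1" "e \<le> y" "d = r * e"
      using r d dy by (auto simp: e_def)
    have "h (r * y) - h (r * y - d) = c * (h y - h (y - e))"
      using c'[of y] c'[of "y - e"] e y by (simp add: algebra_simps)
    also have "\<dots> = C * (c * h e)"
      using C(2)[rule_format, of e] e by simp
    also have "\<dots> = C * h d"
      using c'[of e] e y by simp
    finally show "h (r * y) - h (r * y - d) = C * h d" .
  qed (use r in auto)
  have inc': "h z - h (z - d) = C * h d" if "z \<in> {y / 2..y}" "0 \<le> d" "d < \<epsilon> / 2" for z d
    using inc[of d "z / y"] that y by (simp add: field_simps)
  have "\<epsilon> > 0" "\<epsilon> \<le> y"
    using C(1) y(1) by (auto simp: \<epsilon>_def)
  with inc' show ?thesis
    unfolding y_def by blast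
qed

text \<open>The decrements of \<open>h\<close> at \<open>y\<close> and at \<open>y - d1\<close>
  follow the same law, so \<open>\<phi>\<close> is additive and Cauchy's equation applies.\<close>

lemma affine_on_left_neighbourhood:
  "\<exists>N e A. e > 0 \<and> (\<forall>d\<ge>0. d \<le> e \<longrightarrow> h (1 / 2 ^ N - d) = h (1 / 2 ^ N) - A * d)"
proof -
  obtain N C \<epsilon> where \<epsilon>: "\<epsilon> > 0" "\<epsilon> \<le> 1 / 2 ^ N" and inc:
    "\<forall>z\<in>{1 / 2 ^ N / 2..1 / 2 ^ N}. \<forall>d\<ge>0. d < \<epsilon> / 2 \<longrightarrow> h z - h (z - d) = C * h d"
    using translation_invariant_increment by blast
  define y :: real where "y = 1 / 2 ^ N"
  have y: "\<epsilon> \<le> y" "y \<le> 1"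
    using \<epsilon> by (auto simp: y_def)
  note inc = inc[folded y_def, rule_format]
  define \<phi> where "\<phi> d = h y - h (y - d)" for d
  \<comment> \<open>With \<open>\<epsilon> / 3\<close> the steps stay strictly below
    \<open>\<epsilon> / 2\<close>, and the base point \<open>y - d1\<close> stays above
    \<open>y / 2\<close>.\<close>
  have "\<phi> d = \<phi> (\<epsilon> / 3) / (\<epsilon> / 3) * d" if "d \<in> {0..\<epsilon> / 3}" for d
  proof (rule additive_on_interval_linear)
    have "continuous_on {0..\<epsilon> / 3} (\<lambda>d. h (y - d))"
      by (rule continuous_on_compose2[OF h_continuous])
        (use \<epsilon> y in \<open>fastforce intro!: continuous_intros\<close>)+
    then show "continuous_on {0..\<epsilon> / 3} \<phi>"
      unfolding \<phi>_def by (intro continuous_intros)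
    show "\<phi> (d1 + d2) = \<phi> d1 + \<phi> d2" if "0 \<le> d1" "0 \<le> d2" "d1 + d2 \<le> \<epsilon> / 3" for d1 d2
      using inc[of y d2] inc[of "y - d1" d2] that \<epsilon>(1) y by (simp add: \<phi>_def algebra_simps)
  qed (use \<epsilon> that in auto)
  then have "h (y - d) = h y - \<phi> (\<epsilon> / 3) / (\<epsilon> / 3) * d" if "0 \<le> d" "d \<le> \<epsilon> / 3" for d
    unfolding \<phi>_def using that by (simp only: atLeastAtMost_iff) (smt (verit))
  moreover have "\<epsilon> / 3 > 0"
    using \<epsilon>(1) by simp
  ultimately show ?thesis
    unfolding y_def by blast
qed

section \<open>From one affine germ to the whole unit interval\<close>

lemma h_piecewise_linear: "piecewise_linear_on {0..1} h"
proof -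
  obtain N e A where A: "e > 0" "\<forall>d\<ge>0. d \<le> e \<longrightarrow> h (1 / 2 ^ N - d) = h (1 / 2 ^ N) - A * d"
    using affine_on_left_neighbourhood by blast
  obtain m where m: "(1 / 2 :: real) ^ m < e"
    using real_arch_pow_inv[of e "1 / 2"] A(1) by auto
  \<comment> \<open>Here \<open>n > N\<close> lets the iterate fold at \<open>1 / 2 ^ N\<close>, and
    \<open>n \<ge> m\<close> makes the interval of length \<open>1 / 2 ^ n\<close> to its left fit
    into the affine zone.\<close>
  define n where "n = max m (Suc N)"
  have n: "N < n" "m \<le> n"
    by (auto simp: n_def)
  have "(1 / 2 :: real) ^ n \<le> (1 / 2) ^ m"
    using n by (intro power_decreasing) auto
  then have n': "1 / 2 ^ n \<le> e"
    using m by (simp add: power_one_over)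
  define l where "l s = h (1 / 2 ^ N - s / 2 ^ n)" for s
  have "piecewise_linear_on {0..1} l"
  proof (rule piecewise_linear_on_affine)
    fix s :: real assume s: "s \<in> {0..1}"
    then have "s / 2 ^ n \<le> e"
      using n' divide_right_mono[of s 1 "2 ^ n"] by simp
    then show "l s = - (A / 2 ^ n) * s + h (1 / 2 ^ N)"
      using A(2)[rule_format, of "s / 2 ^ n"] s by (simp add: l_def)
  qed (auto simp: is_interval_cc)
  moreover have "piecewise_linear_on {0..1} (g ^^ n)"
    by (rule piecewise_linear_on_funpow) (use g_props in \<open>auto simp: is_interval_cc\<close>)
  moreover have "l ` {0..1} \<subseteq> {0..1}"
    unfolding l_def using h_via_left_neighbourhood(2)[OF n(1)] h_in_unit by blast
  ultimately have "piecewise_linear_on {0..1} (\<lambda>s. (g ^^ n) (l s))"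
    by (rule piecewise_linear_on_compose)
  then show ?thesis
    by (rule piecewise_linear_on_cong) (use h_via_left_neighbourhood(1)[OF n(1)] in \<open>simp add: l_def\<close>)
qed

end

theorem theorem3:
  fixes g h :: "real \<Rightarrow> real"
  assumes "carcass g"
    and "conjugacy tent g h"
    and "\<And>\<psi> :: real \<Rightarrow> real.
           \<lbrakk> continuous_on {0..1} \<psi>; \<psi> ` {0..1} = {0..1};
             \<forall>x\<in>{0..1}. \<psi> (g x) = g (\<psi> x) \<rbrakk> \<Longrightarrow> piecewise_linear_on {0..1} \<psi>"
  shows "piecewise_linear_on {0..1} h"
proof -
  obtain k where "homeomorphism {0..1} {0..1} h k"
    using assms(2) unfolding conjugacy_def by blast
  then interpret piecewise_linear_centralizer g h k
    using assms by unfold_locales (auto simp: conjugacy_def)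
  show ?thesis
    by (rule h_piecewise_linear)
qed

end
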